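(* Let $m,n,t$ be positive integers with $2^t \leq m \leq 2^n$. Then $$D(m,n,2t+1) \ \leq\ \left(\frac{16e}{2t+1}\right)^{2t+1}\cdot (n\cdot \ell)^t\cdot m\cdot \log m,$$ where $$\ell=\ell(m)=\min\left\{\left\lceil \frac{2\log m}{\log n-\log\log m}\right\rceil,\ \lfloor \log m\rfloor\right\}.$$
   Context: All logarithms $\log$ are base two, and $e$ is the base of the natural logarithm. For positive integers $n,r$, $Q_n^r$ is the graph with vertex set $\{0,1\}^n$ in which two distinct vectors are adjacent if and only if they differ in at most $r$ coordinates (Hamming distance at most $r$). For $\mathcal{A}\subseteq\{0,1\}^n$, $e_{Q_n^r}(\mathcal{A})$ is the number of edges of $Q_n^r$ with both endpoints in $\mathcal{A}$. For $m\le 2^n$, $D(m,n,r):=\max\{e_{Q_n^r}(\mathcal{A}) : \mathcal{A}\subseteq\{0,1\}^n,\ |\mathcal{A}|=m\}$. Convention: when $\log m=n$ (so that the denominator $\log n-\log\log m$ is zero), the first term in the minimum is read as $+\infty$, so $\ell=\lfloor\log m\rfloor$. *)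

theory Defs
  imports "HOL-Analysis.Analysis"
begin

definition cube :: "nat \<Rightarrow> (nat \<Rightarrow> nat) set" where
  "cube n = {..<n} \<rightarrow>\<^sub>E {0, 1}"

definition hamming :: "nat \<Rightarrow> (nat \<Rightarrow> nat) \<Rightarrow> (nat \<Rightarrow> nat) \<Rightarrow> nat" where
  "hamming n x y = card {i \<in> {..<n}. x i \<noteq> y i}"

definition Q_adj :: "nat \<Rightarrow> nat \<Rightarrow> (nat \<Rightarrow> nat) \<Rightarrow> (nat \<Rightarrow> nat) \<Rightarrow> bool" where
  "Q_adj n r x y \<longleftrightarrow> x \<in> cube n \<and> y \<in> cube n \<and> x \<noteq> y \<and> hamming n x y \<le> r"

definition Q_edges :: "nat \<Rightarrow> nat \<Rightarrow> (nat \<Rightarrow> nat) set set" where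
  "Q_edges n r = {{x, y} | x y. Q_adj n r x y}"

definition edges_in :: "nat \<Rightarrow> nat \<Rightarrow> (nat \<Rightarrow> nat) set \<Rightarrow> nat" where
  "edges_in n r A = card {e \<in> Q_edges n r. e \<subseteq> A}"

(* Meaningful for m \<le> 2 ^ n, where the maximum is over a nonempty finite set. *)
definition D :: "nat \<Rightarrow> nat \<Rightarrow> nat \<Rightarrow> nat" where
  "D m n r = Max {edges_in n r A | A. A \<subseteq> cube n \<and> card A = m}"

(* For log 2 m = n the denominator vanishes and the quotient is read as infinity
   (in HOL it would be 0), so the minimum is its second argument. *)
definition ell :: "nat \<Rightarrow> nat \<Rightarrow> int" where
  "ell m n =
     (if log 2 (real m) = real n then \<lfloor>log 2 (real m)\<rfloor>
      else min \<lceil>2 * log 2 (real m) / (log 2 (real n) - log 2 (log 2 (real m)))\<rceil>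
               \<lfloor>log 2 (real m)\<rfloor>)"

end

theory Submission
  imports Defs
begin

text \<open>
  Write L = log m, r = 2t + 1, and identify a point of the cube with the set of its coordinates
  equal to 1, so that the distance of X and Y is the size of their symmetric difference.

  Two kinds of compression, deleting an element from the sets and replacing an element by a
  smaller one, keep the size of a family and do not lose pairs at distance at most r (lemma
  \<open>exists_compressed_family\<close>). So the extremal family may be taken to be closed under both. Every
  member X then contributes all its subsets, so it has at most L elements. Moreover X has few
  elements beyond the threshold q = sqrt(nL): if there are p of them, then they can be moved down
  to any p positions below q, hence m is at least the number of p-subsets of q points, which is
  at least (q/L)^p = (n/L)^(p/2). So p is at most 2L / (log n - log L), which is where the first
  term in the minimum defining \<open>ell\<close> comes from. Let P be this term or L, according to which term
  of the minimum is smaller; it bounds the number of elements beyond q.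

  Now count the Y near a given X. A change of X below q deletes one of at most L elements or
  inserts one of about q; a change beyond q deletes one of at most P or inserts one of at most n.
  If a, b, c, d count the changes of these kinds (deletions below and beyond q, insertions below
  and beyond q), then the number of choices seen from X is about L^a P^b q^c n^d, and seen from Y
  it is q^a n^b L^c P^d. The product of both numbers is (Lq)^(a+c) (nP)^(b+d), and Lq is at most
  nP, as L/P is at most log (n/L) / 2 or equal to 1; so the geometric mean is at most (nP)^(r/2).
  For odd r the smaller of the two numbers is at most (nP)^t L, which is lemma
  \<open>min_product_bound\<close>. Charging every pair to its cheaper endpoint gives the theorem up to the
  constant.

  For the constant, the Y that are cheap from X are counted with weights: give the change of
  coordinate i the weight z / cost(i) and sum the products of weights over all sets of changes.
  The sum is at most the exponential of the sum of the weights, that is at most exp(4z), because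
  the cost of each of the four kinds of change is at least the number of changes of that kind. The
  choice z = r/4 yields (4e/r)^r, and two factors 2^r are lost in rounding q and in bounding P by
  2 \<open>ell\<close>.
\<close>

section \<open>Compressions\<close>

definition adjacent_pairs :: "('a \<Rightarrow> 'a \<Rightarrow> bool) \<Rightarrow> 'a set \<Rightarrow> ('a \<times> 'a) set" where
  "adjacent_pairs E A = {(x, y). x \<in> A \<and> y \<in> A \<and> E x y}"

text \<open>
  Polarisation treats both compressions at once. An involution \<open>\<sigma>\<close> (delete or insert a fixed
  element, or exchange two elements) moves the points of U off U, and a point of A in U is moved
  whenever its image is still free.
\<close>
definition movable :: "('a \<Rightarrow> 'a) \<Rightarrow> 'a set \<Rightarrow> 'a set \<Rightarrow> 'a set" where
  "movable \<sigma> U A = {x \<in> A \<inter> U. \<sigma> x \<notin> A}"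

definition polarise :: "('a \<Rightarrow> 'a) \<Rightarrow> 'a set \<Rightarrow> 'a set \<Rightarrow> 'a set" where
  "polarise \<sigma> U A = (A - movable \<sigma> U A) \<union> \<sigma> ` movable \<sigma> U A"

lemma finite_adjacent_pairs: "finite A \<Longrightarrow> finite (adjacent_pairs E A)"
  by (rule finite_subset[of _ "A \<times> A"]) (auto simp: adjacent_pairs_def)

lemma sum_polarise:
  fixes f :: "'a \<Rightarrow> 'b::comm_monoid_add"
  assumes "finite A" and inv: "\<And>x. \<sigma> (\<sigma> x) = x"
  shows "sum f (polarise \<sigma> U A) = sum f (A - movable \<sigma> U A) + sum (f \<circ> \<sigma>) (movable \<sigma> U A)"
proof -
  let ?B = "movable \<sigma> U A"
  have "inj_on \<sigma> ?B" by (metis inj_onI inv)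
  moreover have "sum f ((A - ?B) \<union> \<sigma> ` ?B) = sum f (A - ?B) + sum f (\<sigma> ` ?B)"
    using assms(1) by (intro sum.union_disjoint) (auto simp: movable_def)
  ultimately show ?thesis by (simp add: polarise_def sum.reindex)
qed

lemma card_polarise:
  assumes "finite A" and "\<And>x. \<sigma> (\<sigma> x) = x"
  shows "card (polarise \<sigma> U A) = card A"
proof -
  have B: "movable \<sigma> U A \<subseteq> A" by (auto simp: movable_def)
  have "card (polarise \<sigma> U A) = sum (\<lambda>_. 1) (polarise \<sigma> U A)" by simp
  also have "\<dots> = card (A - movable \<sigma> U A) + card (movable \<sigma> U A)"
    by (subst sum_polarise) (use assms in \<open>auto simp: o_def\<close>)
  also have "\<dots> = card A" using B assms(1) 
    by (metis card_Diff_subset card_mono finite_subset le_add_diff_inverse2)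
  finally show ?thesis .
qed

lemma sum_polarise_less:
  fixes w :: "'a \<Rightarrow> nat"
  assumes "finite A" and "\<And>x. \<sigma> (\<sigma> x) = x"
    and less: "\<And>x. x \<in> A \<Longrightarrow> x \<in> U \<Longrightarrow> w (\<sigma> x) < w x"
    and x: "x \<in> A" "x \<in> U" "\<sigma> x \<notin> A"
  shows "sum w (polarise \<sigma> U A) < sum w A"
proof -
  let ?B = "movable \<sigma> U A"
  have B: "?B \<subseteq> A" "x \<in> ?B" using x by (auto simp: movable_def)
  have "finite ?B" using B assms(1) finite_subset by blast
  then have "sum (w \<circ> \<sigma>) ?B < sum w ?B"
    by (rule sum_strict_mono) (use B less in \<open>auto simp: movable_def\<close>)
  moreover have "sum w A = sum w (A - ?B) + sum w ?B"
    using B assms(1) by (simp add: sum.subset_diff)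
  ultimately show ?thesis using sum_polarise[of A \<sigma> w U] assms(1,2) by simp
qed

text \<open>
  Polarisation loses no adjacent pair provided that moving two points to the same side of \<open>\<sigma>\<close>
  keeps them adjacent (\<open>closer\<close>). Adjacent pairs are mapped injectively to adjacent pairs: a
  pair of two moved or of two unmoved points has an evident image. If only x moves and y is not
  adjacent to \<open>\<sigma> x\<close>, then y is not fixed by \<open>\<sigma>\<close>, by \<open>closer\<close> it lies in U, and it stayed because \<open>\<sigma> y\<close> is in
  the set as well; so \<open>(\<sigma> x, \<sigma> y)\<close> serves as the image. It is not used twice: it would also be the
  image of \<open>(x, \<sigma> y)\<close>, but that pair is not adjacent, as y is not adjacent to \<open>\<sigma> x\<close>.
\<close>
lemma card_adjacent_pairs_polarise:
  assumes fin: "finite A"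
    and inv: "\<And>x. \<sigma> (\<sigma> x) = x"
    and aut: "\<And>x y. E (\<sigma> x) (\<sigma> y) = E x y"
    and sym: "\<And>x y. E x y \<Longrightarrow> E y x"
    and side: "\<And>x. x \<in> U \<Longrightarrow> \<sigma> x \<notin> U"
    and fixd: "\<And>x. x \<notin> U \<Longrightarrow> \<sigma> x \<notin> U \<Longrightarrow> \<sigma> x = x"
    and closer: "\<And>x y. \<lbrakk>x \<in> A; y \<in> A; x \<in> U; \<sigma> y \<in> U; \<sigma> y \<noteq> x; E x y\<rbrakk> \<Longrightarrow> E x (\<sigma> y)"
  shows "card (adjacent_pairs E A) \<le> card (adjacent_pairs E (polarise \<sigma> U A))"
proof -
  define B where "B = movable \<sigma> U A"
  have A': "polarise \<sigma> U A = (A - B) \<union> \<sigma> ` B" by (simp add: polarise_def B_def)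
  have B: "x \<in> A" "x \<in> U" "\<sigma> x \<notin> A" if "x \<in> B" for x
    using that by (auto simp: B_def movable_def)
  have notB: "\<sigma> x \<in> A" if "x \<in> A" "x \<in> U" "x \<notin> B" for x
    using that by (auto simp: B_def movable_def)
  have eq: "E (\<sigma> x) y \<longleftrightarrow> E x (\<sigma> y)" for x y using aut[of x "\<sigma> y"] inv by simp
  define g where "g x y = (if E (\<sigma> x) y then y else \<sigma> y)" for x y
  define f where "f p = (case p of (x, y) \<Rightarrow>
     if x \<in> B then (if y \<in> B then (\<sigma> x, \<sigma> y) else (\<sigma> x, g x y))
     else (if y \<in> B then (g y x, \<sigma> y) else (x, y)))" for p
  have g: "g x y \<in> A - B \<and> E (\<sigma> x) (g x y)" if xy: "x \<in> B" "y \<in> A" "y \<notin> B" "E x y" for x y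
  proof (cases "E (\<sigma> x) y")
    case True
    then show ?thesis using xy by (simp add: g_def)
  next
    case False
    then have n: "\<not> E x (\<sigma> y)" using eq by simp
    have "y \<in> U"
    proof (rule ccontr)
      assume y: "y \<notin> U"
      show False
      proof (cases "\<sigma> y \<in> U")
        case True
        have "\<sigma> y \<noteq> x" using B(3)[OF xy(1)] xy(2) inv by auto
        then show False using closer[of x y] B[OF xy(1)] xy True n by blast
      next
        case False
        then show False using fixd[OF y] n xy(4) by simp
      qed
    qed
    then have "\<sigma> y \<in> A" "\<sigma> y \<notin> B" using notB xy side B(2) by blast+
    then show ?thesis using False xy aut by (simp add: g_def)
  qed
  have ginj: "y = y'" if "E x y" "E x y'" "g x y = g x y'" for x y y'
    using that eq inv unfolding g_def by (metis (full_types))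
  have sB: "\<sigma> x \<notin> A" "\<sigma> x = \<sigma> y \<longleftrightarrow> x = y" if "x \<in> B" for x y
    using B(3)[OF that] inv by metis+
  have "f ` adjacent_pairs E A \<subseteq> adjacent_pairs E (polarise \<sigma> U A)"
  proof (rule image_subsetI)
    fix p assume p: "p \<in> adjacent_pairs E A"
    obtain x y where p_eq: "p = (x, y)" by (cases p)
    with p have xy: "x \<in> A" "y \<in> A" "E x y" by (auto simp: adjacent_pairs_def)
    have "f (x, y) \<in> adjacent_pairs E (polarise \<sigma> U A)"
    proof (cases "x \<in> B")
      case True
      then show ?thesis using xy g[of x y] aut by (auto simp: f_def adjacent_pairs_def A')
    next
      case False
      show ?thesis
      proof (cases "y \<in> B")
        case True
        then have "g y x \<in> A - B" "E (\<sigma> y) (g y x)" using g[of y x] False xy sym by blast+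
        then show ?thesis using sym True False by (auto simp: f_def adjacent_pairs_def A')
      qed (use False xy in \<open>auto simp: f_def adjacent_pairs_def A'\<close>)
    qed
    then show "f p \<in> adjacent_pairs E (polarise \<sigma> U A)" by (simp add: p_eq)
  qed
  moreover have "inj_on f (adjacent_pairs E A)"
  proof (rule inj_onI, clarify)
    fix x y x' y'
    assume "(x, y) \<in> adjacent_pairs E A" "(x', y') \<in> adjacent_pairs E A" and f: "f (x, y) = f (x', y')"
    then have xy: "x \<in> A" "y \<in> A" "E x y" "E y x" "x' \<in> A" "y' \<in> A" "E x' y'" "E y' x'"
      by (auto simp: adjacent_pairs_def intro: sym)
    have gs: "z \<in> B \<Longrightarrow> v \<in> A \<Longrightarrow> v \<notin> B \<Longrightarrow> E z v \<Longrightarrow> g z v \<in> A" for z v using g by blast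
    show "x = x' \<and> y = y'"
      using f xy gs[of x y] gs[of y x] gs[of x' y'] gs[of y' x'] sB[of x] sB[of y] sB[of x'] sB[of y']
        ginj[of x y y'] ginj[of y x x']
      unfolding f_def by (auto split: if_splits)
  qed
  moreover have "finite (adjacent_pairs E (polarise \<sigma> U A))"
    using fin by (intro finite_adjacent_pairs) (auto simp: polarise_def movable_def)
  ultimately show ?thesis by (metis card_inj_on_le)
qed

definition near :: "nat \<Rightarrow> nat set \<Rightarrow> nat set \<Rightarrow> bool" where
  "near r X Y \<longleftrightarrow> X \<noteq> Y \<and> card (sym_diff X Y) \<le> r"

definition toggle :: "nat \<Rightarrow> nat set \<Rightarrow> nat set" where
  "toggle i X = sym_diff X {i}"

definition swap :: "nat \<Rightarrow> nat \<Rightarrow> nat set \<Rightarrow> nat set" where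
  "swap i j X = Transposition.transpose i j ` X"

lemma near_commute: "near r X Y \<Longrightarrow> near r Y X"
  by (auto simp: near_def Un_commute)

lemma toggle_toggle [simp]: "toggle i (toggle i X) = X"
  by (auto simp: toggle_def)

lemma near_toggle: "near r (toggle i X) (toggle i Y) = near r X Y"
proof -
  have "sym_diff (toggle i X) (toggle i Y) = sym_diff X Y" by (auto simp: toggle_def)
  moreover have "toggle i X = toggle i Y \<longleftrightarrow> X = Y" by (metis toggle_toggle)
  ultimately show ?thesis by (simp add: near_def)
qed

lemma swap_swap [simp]: "swap i j (swap i j X) = X"
  by (simp add: swap_def image_image)

lemma near_swap: "near r (swap i j X) (swap i j Y) = near r X Y"
proof -
  have "sym_diff (swap i j X) (swap i j Y) = Transposition.transpose i j ` sym_diff X Y"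
    unfolding swap_def by (simp add: image_Un image_set_diff)
  moreover have "card (Transposition.transpose i j ` sym_diff X Y) = card (sym_diff X Y)"
    by (simp add: card_image)
  moreover have "swap i j X = swap i j Y \<longleftrightarrow> X = Y" by (metis swap_swap)
  ultimately show ?thesis by (simp add: near_def)
qed

lemma mem_swap: "k \<in> swap i j X \<longleftrightarrow> Transposition.transpose i j k \<in> X"
  unfolding swap_def by (metis image_iff transpose_involutory)

lemma swap_eq: "j \<in> X \<Longrightarrow> i \<notin> X \<Longrightarrow> swap i j X = insert i (X - {j})"
  by (auto simp: mem_swap Transposition.transpose_def split: if_splits)

text \<open>
  A potential that every compression decreases. The summand for i is i + 1 and not i so
  that deleting the element 0 decreases it too.
\<close>
definition position_sum :: "nat set \<Rightarrow> nat" where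
  "position_sum X = (\<Sum>i\<in>X. i + 1)"

lemma near_mono:
  assumes "near r X Y" "X \<noteq> Z" "sym_diff X Z \<subseteq> sym_diff X Y" "finite X" "finite Y"
  shows "near r X Z"
proof -
  have "card (sym_diff X Z) \<le> card (sym_diff X Y)"
    using assms by (intro card_mono) auto
  then show ?thesis using assms by (auto simp: near_def)
qed

text \<open>
  Among the families with the given size and at least as many near pairs, one that minimises
  the total position sum is fixed by all compressions.
\<close>
lemma exists_compressed_family:
  fixes \<A> :: "nat set set"
  assumes \<A>: "\<A> \<subseteq> Pow {..<n}"
  obtains \<B> where "\<B> \<subseteq> Pow {..<n}" "card \<B> = card \<A>"
    "card (adjacent_pairs (near r) \<A>) \<le> card (adjacent_pairs (near r) \<B>)"
    "\<And>X i. X \<in> \<B> \<Longrightarrow> i \<in> X \<Longrightarrow> X - {i} \<in> \<B>"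
    "\<And>X i j. \<lbrakk>X \<in> \<B>; j \<in> X; i \<notin> X; i < j\<rbrakk> \<Longrightarrow> insert i (X - {j}) \<in> \<B>"
proof -
  define admissible where "admissible \<B> \<longleftrightarrow> \<B> \<subseteq> Pow {..<n} \<and> card \<B> = card \<A> \<and>
    card (adjacent_pairs (near r) \<A>) \<le> card (adjacent_pairs (near r) \<B>)" for \<B>
  have "admissible \<A>" using \<A> by (simp add: admissible_def)
  then obtain \<B> where ad: "admissible \<B>"
    and least: "\<And>\<C>. admissible \<C> \<Longrightarrow> sum position_sum \<B> \<le> sum position_sum \<C>"
    using ex_has_least_nat[of admissible \<A> "sum position_sum"] by blast
  have \<B>: "\<B> \<subseteq> Pow {..<n}" using ad by (simp add: admissible_def)
  then have fin: "finite \<B>" by (rule finite_subset) simp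
  have finX: "finite X" if "X \<in> \<B>" for X using that \<B> finite_subset by blast
  have stable: "\<sigma> X \<in> \<B>"
    if inv: "\<And>X. \<sigma> (\<sigma> X) = X"
      and aut: "\<And>X Y. near r (\<sigma> X) (\<sigma> Y) = near r X Y"
      and side: "\<And>X. X \<in> U \<Longrightarrow> \<sigma> X \<notin> U"
      and fixd: "\<And>X. X \<notin> U \<Longrightarrow> \<sigma> X \<notin> U \<Longrightarrow> \<sigma> X = X"
      and closer: "\<And>X Y. \<lbrakk>X \<in> \<B>; Y \<in> \<B>; X \<in> U; \<sigma> Y \<in> U; \<sigma> Y \<noteq> X; near r X Y\<rbrakk> \<Longrightarrow> near r X (\<sigma> Y)"
      and range: "\<And>X. X \<in> \<B> \<Longrightarrow> X \<in> U \<Longrightarrow> \<sigma> X \<subseteq> {..<n}"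
      and less: "\<And>X. X \<in> \<B> \<Longrightarrow> X \<in> U \<Longrightarrow> position_sum (\<sigma> X) < position_sum X"
      and X: "X \<in> \<B>" "X \<in> U" for \<sigma> U X
  proof (rule ccontr)
    assume n: "\<sigma> X \<notin> \<B>"
    have "card (adjacent_pairs (near r) \<B>) \<le> card (adjacent_pairs (near r) (polarise \<sigma> U \<B>))"
      by (rule card_adjacent_pairs_polarise) (fact fin inv aut near_commute side fixd closer)+
    moreover have "card (polarise \<sigma> U \<B>) = card \<B>"
      by (rule card_polarise) (fact fin inv)+
    moreover have "polarise \<sigma> U \<B> \<subseteq> Pow {..<n}"
      using \<B> range by (auto simp: polarise_def movable_def)
    ultimately have "admissible (polarise \<sigma> U \<B>)"
      using ad by (auto simp: admissible_def)
    moreover have "sum position_sum (polarise \<sigma> U \<B>) < sum position_sum \<B>"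
      by (rule sum_polarise_less) (fact fin inv less X n)+
    ultimately show False using least by fastforce
  qed
  have down: "X - {i} \<in> \<B>" if X: "X \<in> \<B>" "i \<in> X" for X i
  proof -
    have "toggle i X \<in> \<B>"
    proof (rule stable[where \<sigma> = "toggle i" and U = "{X. i \<in> X}"])
      show "near r X (toggle i Y)" if "X \<in> \<B>" "Y \<in> \<B>" "X \<in> {X. i \<in> X}" "toggle i Y \<in> {X. i \<in> X}"
        "toggle i Y \<noteq> X" "near r X Y" for X Y
        by (rule near_mono[OF that(6)]) (use that finX in \<open>auto simp: toggle_def\<close>)
      show "position_sum (toggle i X) < position_sum X" if "X \<in> \<B>" "X \<in> {X. i \<in> X}" for X
      proof -
        have "toggle i X = X - {i}" using that by (auto simp: toggle_def)
        then show ?thesis using that finX[OF that(1)] unfolding position_sum_def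
          by (simp add: sum.remove[of X i])
      qed
      show "toggle i X \<subseteq> {..<n}" if "X \<in> \<B>" "X \<in> {X. i \<in> X}" for X
        using that \<B> by (auto simp: toggle_def)
    qed (use X near_toggle in \<open>auto simp: toggle_def\<close>)
    moreover have "toggle i X = X - {i}" using X by (auto simp: toggle_def)
    ultimately show ?thesis by simp
  qed
  have shift: "insert i (X - {j}) \<in> \<B>" if X: "X \<in> \<B>" "j \<in> X" "i \<notin> X" "i < j" for X i j
  proof -
    let ?U = "{X. j \<in> X \<and> i \<notin> X}"
    have "swap i j X \<in> \<B>"
    proof (rule stable[where \<sigma> = "swap i j" and U = ?U])
      show "near r X (swap i j Y)" if "X \<in> \<B>" "Y \<in> \<B>" "X \<in> ?U" "swap i j Y \<in> ?U"
        "swap i j Y \<noteq> X" "near r X Y" for X Y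
      proof (rule near_mono[OF that(6)])
        have "i \<in> Y" "j \<notin> Y" using that(4) by (auto simp: mem_swap)
        then show "sym_diff X (swap i j Y) \<subseteq> sym_diff X Y"
          using that(3) \<open>i < j\<close> by (auto simp: mem_swap Transposition.transpose_def split: if_splits)
      qed (use that finX in auto)
      show "position_sum (swap i j X) < position_sum X" if "X \<in> \<B>" "X \<in> ?U" for X
      proof -
        have "swap i j X = insert i (X - {j})" using that by (simp add: swap_eq)
        then show ?thesis using that finX[OF that(1)] \<open>i < j\<close> unfolding position_sum_def
          by (simp add: sum.remove[of X j])
      qed
      show "swap i j X \<subseteq> {..<n}" if "X \<in> \<B>" "X \<in> ?U" for X
        using that \<B> \<open>i < j\<close> by (force simp: swap_eq)
      show "swap i j X = X" if "X \<notin> ?U" "swap i j X \<notin> ?U" for X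
        using that \<open>i < j\<close> by (auto simp: mem_swap Transposition.transpose_def split: if_splits)
    qed (use X near_swap in \<open>auto simp: mem_swap\<close>)
    then show ?thesis using X by (simp add: swap_eq)
  qed
  show ?thesis using that[of \<B>] ad down shift by (auto simp: admissible_def)
qed

section \<open>Sizes of the members of a compressed family\<close>

lemma down_closed_subset:
  assumes down: "\<And>X i. X \<in> \<B> \<Longrightarrow> i \<in> X \<Longrightarrow> X - {i} \<in> \<B>"
    and "X \<in> \<B>" "finite X" "Y \<subseteq> X"
  shows "Y \<in> \<B>"
proof -
  have "finite (X - Y)" using assms by simp
  then have "X - Z \<in> \<B>" if "Z = X - Y" for Z
  proof -
    have "finite Z" using that \<open>finite X\<close> by simp
    then show ?thesis
    proof (induction Z)
      case empty
      then show ?case using \<open>X \<in> \<B>\<close> by simp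
    next
      case (insert z Z)
      have eq: "X - insert z Z = (X - Z) - {z}" by auto
      show ?case
      proof (cases "z \<in> X - Z")
        case True
        then show ?thesis using down[OF insert.IH True] eq by simp
      next
        case False
        then show ?thesis using insert.IH eq by simp
      qed
    qed
  qed
  moreover have "X - (X - Y) = Y" using assms by auto
  ultimately show ?thesis by simp
qed

lemma card_le_log_card_family:
  assumes down: "\<And>X i. X \<in> \<B> \<Longrightarrow> i \<in> X \<Longrightarrow> X - {i} \<in> \<B>"
    and "finite \<B>" "X \<in> \<B>" "finite X"
  shows "real (card X) \<le> log 2 (real (card \<B>))"
proof -
  have "Pow X \<subseteq> \<B>" using down_closed_subset[of \<B> X] assms by blast
  then have "2 ^ card X \<le> card \<B>" using card_mono[of \<B> "Pow X"] assms by (simp add: card_Pow)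
  then have "2 ^ card X \<le> real (card \<B>)" by (metis of_nat_le_iff of_nat_numeral of_nat_power)
  then show ?thesis by (simp add: le_log_of_power)
qed

text \<open>
  The elements of X that are not in Y are exchanged one by one for those of Y that are not in X;
  each exchange goes downwards, whichever elements are matched.
\<close>
lemma shifted_replace:
  fixes X Y :: "nat set"
  assumes shift: "\<And>X i j. \<lbrakk>X \<in> \<B>; j \<in> X; i \<notin> X; i < j\<rbrakk> \<Longrightarrow> insert i (X - {j}) \<in> \<B>"
    and "X \<in> \<B>" "finite X" "finite Y" "card X = card Y"
    and "\<And>i j. i \<in> Y - X \<Longrightarrow> j \<in> X - Y \<Longrightarrow> i < j"
  shows "Y \<in> \<B>"
  using assms(2-)
proof (induction "card (Y - X)" arbitrary: X)
  case 0
  then have "Y \<subseteq> X" by simp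
  then have "Y = X" using 0 by (simp add: card_subset_eq)
  then show ?case using 0 by simp
next
  case (Suc k)
  have "card (X - Y) = card (Y - X)"
    using Suc.prems by (simp add: card_Diff_subset_Int Int_commute)
  then obtain i j where ij: "i \<in> Y - X" "j \<in> X - Y"
    using Suc.hyps(2) by (metis card.empty ex_in_conv nat.distinct(1))
  let ?X' = "insert i (X - {j})"
  have "Y - ?X' = (Y - X) - {i}" using ij by auto
  then have "card (Y - ?X') = k" using Suc.hyps(2) ij Suc.prems by simp
  moreover have "?X' \<in> \<B>" using shift[of X j i] Suc.prems ij by blast
  moreover have "card ?X' = card Y"
  proof -
    have "card X = Suc (card (X - {j}))" using card.remove[of X j] ij Suc.prems by blast
    moreover have "card ?X' = Suc (card (X - {j}))"
      using ij Suc.prems(2) by (subst card_insert_disjoint) auto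
    ultimately show ?thesis using Suc.prems(4) by simp
  qed
  moreover have "i' < j'" if "i' \<in> Y - ?X'" "j' \<in> ?X' - Y" for i' j'
    using that ij Suc.prems(5)[of i' j'] by auto
  ultimately show ?case using Suc.hyps(1)[of ?X'] Suc.prems by simp
qed

text \<open>
  The part of X beyond h can be moved to any equally large set of positions below h, and all the
  resulting sets belong to the family.
\<close>
lemma choose_le_card_family:
  assumes down: "\<And>X i. X \<in> \<B> \<Longrightarrow> i \<in> X \<Longrightarrow> X - {i} \<in> \<B>"
    and shift: "\<And>X i j. \<lbrakk>X \<in> \<B>; j \<in> X; i \<notin> X; i < j\<rbrakk> \<Longrightarrow> insert i (X - {j}) \<in> \<B>"
    and fin: "finite \<B>" "finite X" and X: "X \<in> \<B>"
  shows "h choose card (X - {..<h}) \<le> card \<B>"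
proof -
  have high: "X - {..<h} \<in> \<B>" using down_closed_subset[OF down X fin(2)] by blast
  have "{Y. Y \<subseteq> {..<h} \<and> card Y = card (X - {..<h})} \<subseteq> \<B>"
  proof clarify
    fix Y assume Y: "Y \<subseteq> {..<h}" "card Y = card (X - {..<h})"
    show "Y \<in> \<B>"
      by (rule shifted_replace[OF shift high])
        (use fin Y in \<open>auto intro: finite_subset[OF Y(1)]\<close>)
  qed
  then have "card {Y. Y \<subseteq> {..<h} \<and> card Y = card (X - {..<h})} \<le> card \<B>"
    by (rule card_mono[OF fin(1)])
  then show ?thesis by (simp add: n_subsets)
qed

text \<open>
  The ratio log w / w is largest at w = e, where it is 1 / (e ln 2) and hence below 2/3.
\<close>
lemma log2_le_two_thirds:
  assumes "0 < (w::real)" shows "log 2 w \<le> 2 / 3 * w"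
proof -
  have "ln (w / exp 1) \<le> w / exp 1 - 1"
    using ln_le_minus_one[of "w / exp 1"] assms by simp
  then have 1: "ln w \<le> w / exp 1" using assms by (simp add: ln_div)
  have "3 / 2 \<le> exp 1 * ln (2::real)"
  proof -
    have "27/10 \<le> exp (1::real)" using e_approx_32 by (simp add: abs_if split: if_splits)
    moreover have "2/3 \<le> ln (2::real)" using ln2_ge_two_thirds .
    ultimately have "27/10 * (2/3) \<le> exp 1 * ln (2::real)" by (intro mult_mono) auto
    then show ?thesis by simp
  qed
  then have "w * (3/2) \<le> w * (exp 1 * ln 2)" using assms by (intro mult_left_mono) auto
  then have "w / exp 1 * (3/2) \<le> w * ln 2" by (simp add: field_simps)
  moreover have "ln w * (3/2) \<le> w / exp 1 * (3/2)" using 1 by (intro mult_right_mono) auto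
  ultimately have "ln w * (3/2) \<le> w * ln 2" by (rule order_trans[rotated])
  then show ?thesis by (simp add: log_def field_simps)
qed

text \<open>
  With w = (n/L)^(1/3) this says that L/P, which is at most (log n - log L) / 2 = (3/2) log w,
  is at most w. The step \<open>few_far\<close> of \<open>min_product_bound\<close> uses it in this form.
\<close>
lemma fourth_power_le:
  fixes L P n :: real
  assumes L: "0 < L" and "L < n" and P: "2 * L / (log 2 n - log 2 L) \<le> P"
  shows "L ^ 4 \<le> n * P ^ 3"
proof -
  define w where "w = root 3 (n / L)"
  have w: "0 < w" "w ^ 3 = n / L" using assms by (simp_all add: w_def)
  have d: "log 2 n - log 2 L = 3 * log 2 w"
  proof -
    have "log 2 n - log 2 L = log 2 (w ^ 3)" using w(2) assms by (simp add: log_divide)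
    then show ?thesis using w(1) by (simp add: log_nat_power)
  qed
  have dpos: "0 < log 2 n - log 2 L" using assms by simp
  have "2 * L \<le> P * (log 2 n - log 2 L)" using P dpos by (simp add: field_simps)
  have P0: "0 < P" using P dpos L by (smt (verit) divide_pos_pos)
  have "P * (log 2 n - log 2 L) \<le> P * (2 * w)"
    using d log2_le_two_thirds[OF w(1)] P0 by (intro mult_left_mono) auto
  with \<open>2 * L \<le> P * (log 2 n - log 2 L)\<close> have "2 * L \<le> P * (2 * w)" by (rule order_trans)
  then have "L \<le> P * w" by simp
  then have "L ^ 3 \<le> (P * w) ^ 3" using L by (intro power_mono) auto
  also have "\<dots> = P ^ 3 * (n / L)" by (simp add: power_mult_distrib w)
  finally show ?thesis using L by (simp add: field_simps power_numeral_reduce)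
qed
text \<open>
  The binomial coefficient is at least (h/p)^p, and h/p is at least
  sqrt(nL) / L = sqrt(n/L); take logarithms.
\<close>
lemma high_part_le:
  fixes L n :: real
  assumes L: "0 < L" "L < n" "L = log 2 m" and m: "0 < m"
    and h: "sqrt (n * L) \<le> real h" and p: "real p \<le> L" and le: "real (h choose p) \<le> m"
  shows "real p \<le> 2 * L / (log 2 n - log 2 L)"
proof (cases "p = 0")
  case True
  then show ?thesis using L by simp
next
  case False
  have "L \<le> sqrt (n * L)" using L by (intro real_le_rsqrt) (simp add: power2_eq_square)
  then have ph: "p \<le> h" using p h by linarith
  have "sqrt (n / L) \<le> real h / real p"
  proof -
    have "sqrt (n / L) = sqrt (n * L) / L" using L by (simp add: real_sqrt_divide real_sqrt_mult field_simps)
    also have "\<dots> \<le> real h / real p" using p h L False by (intro frac_le) auto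
    finally show ?thesis .
  qed
  then have "sqrt (n / L) ^ p \<le> (real h / real p) ^ p" using L by (intro power_mono) auto
  also have "\<dots> \<le> real (h choose p)" using binomial_ge_n_over_k_pow_k[OF ph, where 'a = real] by simp
  also note le
  finally have "sqrt (n / L) ^ p \<le> m" .
  moreover have "0 < sqrt (n / L) ^ p" using L(1,2) by simp
  ultimately have "log 2 (sqrt (n / L) ^ p) \<le> log 2 m" using m by simp
  then have "log 2 (sqrt (n / L) ^ p) \<le> L" using L(3) by simp
  moreover have "log 2 (sqrt (n / L) ^ p) = real p * ((log 2 n - log 2 L) / 2)"
    using L(1,2) by (simp add: log_def ln_realpow ln_sqrt ln_div) (simp add: field_simps)
  moreover have "0 < log 2 n - log 2 L" using L by simp
  ultimately show ?thesis by (simp add: field_simps)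
qed

section \<open>Counting near pairs\<close>

text \<open>
  The two products are the numbers of choices seen from the two endpoints of a pair, and the lemma
  bounds the cheaper one. By induction, a matched deletion and insertion on the same side of the
  threshold can be cancelled from both products, against a factor nP: beyond the threshold they
  contribute exactly nP, and below it Lq, which is at most nP. When nothing can be cancelled,
  at most one kind of change is left on either side of the threshold. If both are deletions or
  both are insertions, then one of the products has only the factors L and P, and the square of L is
  at most nP. The case of deletions on one side and insertions on the other remains, where the
  products are L^a n^d and q^a P^d: the second is small when a is at most 2d, and otherwise the first.
\<close>
lemma min_product_bound:
  fixes L P n q :: real
  assumes P: "1 \<le> P" and PL: "P \<le> L" and Ln: "L \<le> n" and q: "q\<^sup>2 = n * L" "0 \<le> q"
    and key: "L ^ 4 \<le> n * P ^ 3"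
    and sum: "a + b + c + d = 2 * t + 1"
  shows "L ^ a * P ^ b * q ^ c * n ^ d \<le> (n * P) ^ t * L \<or>
         q ^ a * n ^ b * L ^ c * P ^ d \<le> (n * P) ^ t * L"
proof -
  have pos: "0 < P" "0 < L" "0 < n" using P PL Ln by linarith+
  have L3: "L ^ 3 \<le> n * P\<^sup>2"
  proof -
    have "L * L ^ 3 \<le> L * (n * P\<^sup>2)"
    proof -
      have "L * L ^ 3 \<le> P * (n * P\<^sup>2)" using key by (simp add: power_numeral_reduce mult_ac)
      also have "\<dots> \<le> L * (n * P\<^sup>2)" using PL pos by (intro mult_right_mono) auto
      finally show ?thesis .
    qed
    then show ?thesis using pos by simp
  qed
  have L2: "L\<^sup>2 \<le> n * P"
  proof -
    have "L * L\<^sup>2 \<le> P * (n * P)" using L3 by (simp add: power_numeral_reduce mult_ac)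
    also have "\<dots> \<le> L * (n * P)" using PL pos by (intro mult_right_mono) auto
    finally show ?thesis using pos by simp
  qed
  have Lq: "L * q \<le> n * P"
  proof (rule power2_le_imp_le)
    have "(L * q)\<^sup>2 = n * L ^ 3" by (simp only: power_mult_distrib q) (simp add: power_numeral_reduce)
    also have "\<dots> \<le> n * (n * P\<^sup>2)" using L3 pos by simp
    finally show "(L * q)\<^sup>2 \<le> (n * P)\<^sup>2" by (simp add: power_mult_distrib power2_eq_square mult_ac)
  qed (use pos in simp)
  have Lodd: "L ^ (2 * k + 1) \<le> (n * P) ^ k * L" for k
    unfolding power_add power_mult power_one_right
    using L2 pos by (intro mult_right_mono power_mono) auto
  have one_sided: "L ^ a * P ^ b \<le> (n * P) ^ t * L" if "a + b = 2 * t + 1" for a b t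
  proof -
    have "L ^ a * P ^ b \<le> L ^ a * L ^ b" using P PL by (intro mult_left_mono power_mono) auto
    also have "\<dots> \<le> (n * P) ^ t * L" using Lodd[of t] that by (simp add: power_add[symmetric])
    finally show ?thesis .
  qed
  \<comment> \<open>Multiplying by \<open>L ^ e\<close> makes the power of L a multiple of four, so that \<open>key\<close> applies;
    the factor \<open>P ^ e\<close> that this produces is at most \<open>L ^ e\<close>.\<close>
  have few_far: "L ^ a * n ^ d \<le> (n * P) ^ t * L" if s: "a + d = 2 * t + 1" and "2 * d < a" for a d t
  proof -
    define e where "e = 2 * t - 3 * d"
    have d3: "3 * d \<le> 2 * t" using that by linarith
    then have td: "t = d + (t - d)" "2 * t - d + e = 4 * (t - d)" "3 * (t - d) = t + e"
      using d3 unfolding e_def by linarith+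
    have "L ^ e * L ^ (2 * t - d) = (L ^ 4) ^ (t - d)"
      using td(2) by (metis add.commute power_add power_mult)
    also have "\<dots> \<le> (n * P ^ 3) ^ (t - d)" using key pos by (intro power_mono) auto
    also have "\<dots> = n ^ (t - d) * P ^ t * P ^ e"
      using td(3) by (simp add: power_mult_distrib power_mult[symmetric] power_add)
    also have "\<dots> \<le> n ^ (t - d) * P ^ t * L ^ e"
      using PL pos by (intro mult_left_mono power_mono) auto
    finally have "L ^ (2 * t - d) \<le> n ^ (t - d) * P ^ t" using pos by (simp add: mult.commute)
    then have "L ^ (2 * t - d) * (L * n ^ d) \<le> n ^ (t - d) * P ^ t * (L * n ^ d)"
      using pos by (intro mult_right_mono) auto
    moreover have "L ^ a = L ^ (2 * t - d) * L" 
    proof -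
      have "a = Suc (2 * t - d)" using s d3 by linarith
      then show ?thesis by (simp only: power_Suc2)
    qed
    moreover have "n ^ t = n ^ (t - d) * n ^ d" using td(1) by (metis power_add add.commute)
    ultimately show ?thesis by (simp add: power_mult_distrib mult_ac)
  qed
  \<comment> \<open>Each factor \<open>q\<^sup>2\<close> is combined with one factor P: their product is nP times L. For odd a one
    factor q is left, and it is combined with one more P.\<close>
  have many_far: "q ^ a * P ^ d \<le> (n * P) ^ t * L" if s: "a + d = 2 * t + 1" and ad: "a \<le> 2 * d" for a d t
  proof -
    have even: "q ^ (2 * j) * P ^ d \<le> (n * P) ^ t * L" if "2 * j + d = 2 * t + 1" "j \<le> d" for j d t
    proof -
      have "q ^ (2 * j) * P ^ d = (n * P) ^ j * (L ^ j * P ^ (d - j))"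
        using that(2) by (simp add: power_mult q power_mult_distrib flip: power_add)
      also have "\<dots> \<le> (n * P) ^ j * ((n * P) ^ (t - j) * L)"
      proof (rule mult_left_mono)
        have "j + (d - j) = 2 * (t - j) + 1" using that by linarith
        then show "L ^ j * P ^ (d - j) \<le> (n * P) ^ (t - j) * L" by (rule one_sided)
      qed (use pos in simp)
      also have "\<dots> = (n * P) ^ (j + (t - j)) * L" by (simp add: power_add)
      also have "j + (t - j) = t" using that by linarith
      finally show ?thesis .
    qed
    show ?thesis
    proof (cases "even a")
      case True
      then show ?thesis using even[of "a div 2" d t] that by auto
    next
      case False
      then obtain j where a: "a = 2 * j + 1" by (elim oddE)
      obtain d' where d: "d = Suc d'" using ad a by (cases d) auto
      obtain t' where t: "t = Suc t'" using s a d by (cases t) auto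
      have "q ^ a * P ^ d = (q * P) * (q ^ (2 * j) * P ^ d')" by (simp add: a d mult_ac)
      also have "\<dots> \<le> (n * P) * ((n * P) ^ t' * L)"
      proof (rule mult_mono)
        have "q * P \<le> q * L" using PL q by (intro mult_left_mono)
        then show "q * P \<le> n * P" using Lq by (simp add: mult.commute)
        show "q ^ (2 * j) * P ^ d' \<le> (n * P) ^ t' * L"
          using even[of j d' t'] s ad a d t by auto
      qed (use pos q in auto)
      finally show ?thesis by (simp add: t mult_ac)
    qed
  qed
  have mixed: "L ^ a * n ^ d \<le> (n * P) ^ t * L \<or> q ^ a * P ^ d \<le> (n * P) ^ t * L"
    if "a + d = 2 * t + 1" for a d t
    using few_far[OF that] many_far[OF that] by linarith
  show ?thesis using sum
  proof (induction t arbitrary: a b c d)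
    case (0 a b c d)
    then consider "c = 0" "d = 0" | "a = 0" "b = 0" by linarith
    then show ?case
    proof cases
      case 1
      then show ?thesis using one_sided[of a b 0] 0 by simp
    next
      case 2
      then show ?thesis using one_sided[of c d 0] 0 by simp
    qed
  next
    case (Suc t a b c d)
    consider (low) "0 < a" "0 < c" | (high) "0 < b" "0 < d" | (down) "c = 0" "d = 0"
      | (up) "a = 0" "b = 0" | (ad) "b = 0" "c = 0" | (bc) "a = 0" "d = 0" by linarith
    then show ?case
    proof cases
      case low
      then obtain a' c' where ac: "a = Suc a'" "c = Suc c'" by (metis gr0_conv_Suc)
      have step: "(L * q) * x \<le> (n * P) * y" if "x \<le> y" "0 \<le> x" for x y
        by (rule mult_mono[OF Lq that(1)]) (use that pos in auto)
      have "L ^ a' * P ^ b * q ^ c' * n ^ d \<le> (n * P) ^ t * L \<or>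
        q ^ a' * n ^ b * L ^ c' * P ^ d \<le> (n * P) ^ t * L"
        by (rule Suc.IH) (use Suc.prems ac in auto)
      then show ?thesis
        using step[of "L ^ a' * P ^ b * q ^ c' * n ^ d" "(n * P) ^ t * L"]
          step[of "q ^ a' * n ^ b * L ^ c' * P ^ d" "(n * P) ^ t * L"] pos q
        by (simp add: ac mult_ac) blast
    next
      case high
      then obtain b' d' where bd: "b = Suc b'" "d = Suc d'" by (metis gr0_conv_Suc)
      have step: "(n * P) * x \<le> (n * P) * y" if "x \<le> y" for x y
        using that pos by (intro mult_left_mono) auto
      have "L ^ a * P ^ b' * q ^ c * n ^ d' \<le> (n * P) ^ t * L \<or>
        q ^ a * n ^ b' * L ^ c * P ^ d' \<le> (n * P) ^ t * L"
        by (rule Suc.IH) (use Suc.prems bd in auto)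
      then show ?thesis
        using step[of "L ^ a * P ^ b' * q ^ c * n ^ d'" "(n * P) ^ t * L"]
          step[of "q ^ a * n ^ b' * L ^ c * P ^ d'" "(n * P) ^ t * L"]
        by (auto simp: bd mult_ac)
    next
      case down
      then show ?thesis using one_sided[of a b "Suc t"] Suc.prems by simp
    next
      case up
      then show ?thesis using one_sided[of c d "Suc t"] Suc.prems by simp
    next
      case ad
      then show ?thesis using mixed[of a d "Suc t"] Suc.prems by simp
    next
      case bc
      then show ?thesis using mixed[of c b "Suc t"] Suc.prems by (simp add: mult.commute) blast
    qed
  qed
qed

lemma sum_prod_Pow_le_exp:
  fixes c :: "'a \<Rightarrow> real"
  assumes "finite F" "\<And>i. i \<in> F \<Longrightarrow> 0 \<le> c i"
  shows "(\<Sum>D\<in>Pow F. \<Prod>i\<in>D. c i) \<le> exp (\<Sum>i\<in>F. c i)"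
proof -
  have "(\<Sum>D\<in>Pow F. \<Prod>i\<in>D. c i) = (\<Prod>i\<in>F. c i + 1)"
    using prod_add[OF assms(1), of c "\<lambda>_. 1"] by simp
  also have "\<dots> \<le> (\<Prod>i\<in>F. exp (c i))"
    using assms(2) by (intro prod_mono) (auto simp: add.commute[of _ 1])
  also have "\<dots> = exp (\<Sum>i\<in>F. c i)" using assms(1) by (simp add: exp_sum)
  finally show ?thesis .
qed

text \<open>
  The hypothesis \<open>cheap\<close> says that \<open>R / z ^ r\<close> times the product of the weights \<open>z / cost i\<close> over
  the symmetric difference of X and Y is at least 1. So the cardinality is at most the sum of
  these products, and this is at most their sum over all subsets of F. The
  power of z in \<open>cheap\<close> makes up for distances below r.
\<close>
lemma card_cheap_neighbours:
  fixes cost :: "'a \<Rightarrow> real"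
  assumes F: "finite F" "X \<subseteq> F" and \<G>: "\<G> \<subseteq> Pow F"
    and pos: "0 < z" "\<And>i. 0 < cost i"
    and cheap: "\<And>Y. Y \<in> \<G> \<Longrightarrow> card (sym_diff X Y) \<le> r \<and>
      (\<Prod>i\<in>sym_diff X Y. cost i) * z ^ (r - card (sym_diff X Y)) \<le> R"
    and R: "0 \<le> R"
  shows "real (card \<G>) \<le> R / z ^ r * exp (\<Sum>i\<in>F. z / cost i)"
proof -
  let ?w = "\<lambda>D. \<Prod>i\<in>D. z / cost i"
  have w0: "0 \<le> ?w D" for D using pos by (intro prod_nonneg) (auto simp: less_imp_le)
  have one: "1 \<le> R / z ^ r * ?w (sym_diff X Y)" if "Y \<in> \<G>" for Y
  proof -
    let ?D = "sym_diff X Y"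
    have c: "0 < prod cost ?D" using pos by (intro prod_pos) auto
    have "z ^ r = z ^ card ?D * z ^ (r - card ?D)"
      using cheap[OF that] by (simp flip: power_add)
    then have "R / z ^ r * ?w ?D = R / (prod cost ?D * z ^ (r - card ?D))"
      using pos c by (simp add: prod_dividef field_simps)
    moreover have "0 < prod cost ?D * z ^ (r - card ?D)" using c pos by simp
    ultimately show ?thesis using cheap[OF that] by simp
  qed
  have inj: "inj_on (\<lambda>Y. sym_diff X Y) \<G>" by (rule inj_onI) blast
  have "real (card \<G>) = (\<Sum>Y\<in>\<G>. 1)" by simp
  also have "\<dots> \<le> (\<Sum>Y\<in>\<G>. R / z ^ r * ?w (sym_diff X Y))" using one by (rule sum_mono)
  also have "\<dots> = R / z ^ r * sum ?w ((\<lambda>Y. sym_diff X Y) ` \<G>)"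
    using inj by (simp add: sum.reindex sum_distrib_left)
  also have "\<dots> \<le> R / z ^ r * sum ?w (Pow F)"
    using F \<G> w0 R pos by (intro mult_left_mono sum_mono2) auto
  also have "\<dots> \<le> R / z ^ r * exp (\<Sum>i\<in>F. z / cost i)"
    using sum_prod_Pow_le_exp[OF F(1), of "\<lambda>i. z / cost i"] R pos
    by (intro mult_left_mono) (auto simp: less_imp_le)
  finally show ?thesis .
qed

text \<open>
  The cost of changing coordinate i of X is an upper bound for the number of changes of the same
  kind. The threshold h is q rounded up, so there are up to 2q insertions below it.
\<close>
definition flip_cost :: "real \<Rightarrow> real \<Rightarrow> real \<Rightarrow> real \<Rightarrow> nat \<Rightarrow> nat set \<Rightarrow> nat \<Rightarrow> real" where
  "flip_cost L P q n h X i =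
     (if i \<in> X then (if i < h then L else P) else (if i < h then 2 * q else n))"

lemma sum_inverse_flip_cost_le:
  assumes pos: "0 < z" "0 < L" "0 < P" "0 < q" "0 < n" and X: "X \<subseteq> {..<n}"
    and "real (card X) \<le> L" "real (card (X - {..<h})) \<le> P" "real h \<le> 2 * q"
  shows "(\<Sum>i<n. z / flip_cost L P q n h X i) \<le> 4 * z"
proof -
  have fin: "finite X" using X finite_subset by blast
  have S: "(\<Sum>i<n. if i \<in> S then z / C else 0) \<le> z" if "real (card ({..<n} \<inter> S)) \<le> C" "0 < C" for S C
  proof -
    have "(\<Sum>i<n. if i \<in> S then z / C else 0) = real (card ({..<n} \<inter> S)) * (z / C)"
      by (simp add: sum.inter_restrict[symmetric])
    also have "\<dots> \<le> C * (z / C)" using that pos by (intro mult_right_mono) auto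
    finally show ?thesis using that by simp
  qed
  have "(\<Sum>i<n. z / flip_cost L P q n h X i) \<le>
    (\<Sum>i<n. (if i \<in> X then z / L else 0) + (if i \<in> X - {..<h} then z / P else 0) +
      (if i \<in> {..<h} then z / (2 * q) else 0) + (if i \<in> {..<n} then z / n else 0))"
    using pos by (intro sum_mono) (auto simp: flip_cost_def)
  also have "\<dots> \<le> z + z + z + z"
    unfolding sum.distrib
  proof (intro add_mono S)
    show "real (card ({..<n} \<inter> X)) \<le> L" using assms X by (simp add: Int_absorb1)
    have "{..<n} \<inter> (X - {..<h}) = X - {..<h}" using X by auto
    then show "real (card ({..<n} \<inter> (X - {..<h}))) \<le> P" using assms by simp
    have "card ({..<n} \<inter> {..<h}) \<le> h" using card_mono[of "{..<h}" "{..<n} \<inter> {..<h}"] by simp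
    then show "real (card ({..<n} \<inter> {..<h})) \<le> 2 * q" using assms by linarith
  qed (use pos in auto)
  finally show ?thesis by simp
qed

lemma prod_flip_cost:
  assumes "finite X" "finite Y"
  shows "(\<Prod>i\<in>sym_diff X Y. flip_cost L P q n h X i) =
    L ^ card ((X - Y) \<inter> {..<h}) * P ^ card ((X - Y) - {..<h}) *
    (2 * q) ^ card ((Y - X) \<inter> {..<h}) * n ^ card ((Y - X) - {..<h})"
proof -
  have half: "(\<Prod>i\<in>S. flip_cost L P q n h X i) =
    (\<Prod>i\<in>S \<inter> {..<h}. flip_cost L P q n h X i) * (\<Prod>i\<in>S - {..<h}. flip_cost L P q n h X i)"
    if "finite S" for S
    using prod.Int_Diff[OF that] .
  have "(\<Prod>i\<in>sym_diff X Y. flip_cost L P q n h X i) =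
    (\<Prod>i\<in>X - Y. flip_cost L P q n h X i) * (\<Prod>i\<in>Y - X. flip_cost L P q n h X i)"
    using assms by (intro prod.union_disjoint) auto
  also have "(\<Prod>i\<in>X - Y. flip_cost L P q n h X i) =
    L ^ card ((X - Y) \<inter> {..<h}) * P ^ card ((X - Y) - {..<h})"
    using assms by (subst half) (simp_all add: flip_cost_def)
  also have "(\<Prod>i\<in>Y - X. flip_cost L P q n h X i) =
    (2 * q) ^ card ((Y - X) \<inter> {..<h}) * n ^ card ((Y - X) - {..<h})"
    using assms by (subst half) (simp_all add: flip_cost_def)
  finally show ?thesis by (simp add: mult_ac)
qed

text \<open>
  If the distance falls short of 2t + 1 by e, then the factor \<open>z ^ e\<close> is replaced by that of e
  further deletions below the threshold. This factor is larger, namely \<open>L ^ e\<close> seen from X and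
  \<open>q ^ e\<close> seen from Y, and the exponents now have the sum required in \<open>min_product_bound\<close>. The
  power of 2 in R absorbs the factors 2 in the cost 2q.
\<close>
lemma cheap_from_one_side:
  fixes L P n q z :: real
  assumes P: "1 \<le> P" and PL: "P \<le> L" and Ln: "L \<le> n" and q: "q\<^sup>2 = n * L" "0 \<le> q"
    and key: "L ^ 4 \<le> n * P ^ 3" and z: "0 \<le> z" "z \<le> L"
    and fin: "finite X" "finite Y" and k: "card (sym_diff X Y) \<le> 2 * t + 1"
  defines "R \<equiv> 2 ^ (2 * t + 1) * ((n * P) ^ t * L)"
    and "e \<equiv> 2 * t + 1 - card (sym_diff X Y)"
  shows "(\<Prod>i\<in>sym_diff X Y. flip_cost L P q n h X i) * z ^ e \<le> R \<or>
         (\<Prod>i\<in>sym_diff X Y. flip_cost L P q n h Y i) * z ^ e \<le> R"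
proof -
  define a where "a = card ((X - Y) \<inter> {..<h})"
  define b where "b = card ((X - Y) - {..<h})"
  define c where "c = card ((Y - X) \<inter> {..<h})"
  define d where "d = card ((Y - X) - {..<h})"
  have "card (sym_diff X Y) = card (X - Y) + card (Y - X)"
    using fin by (intro card_Un_disjoint) auto
  also have "card (X - Y) = a + b" unfolding a_def b_def using fin
    by (subst card_Un_disjoint[symmetric]) (auto intro: arg_cong[where f = card])
  also have "card (Y - X) = c + d" unfolding c_def d_def using fin
    by (subst card_Un_disjoint[symmetric]) (auto intro: arg_cong[where f = card])
  finally have abcd: "(a + e) + b + c + d = 2 * t + 1" using k by (simp add: e_def)
  have "L\<^sup>2 \<le> q\<^sup>2" using q P PL Ln by (simp add: power2_eq_square)
  then have Lq: "L \<le> q" using q(2) by (rule power2_le_imp_le)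
  have nn: "0 \<le> L" "0 \<le> P" "0 \<le> n" using P PL Ln by linarith+
  have two: "(2::real) ^ j \<le> 2 ^ (2 * t + 1)" if "j \<le> 2 * t + 1" for j
    using that by (intro power_increasing) auto
  have X: "(\<Prod>i\<in>sym_diff X Y. flip_cost L P q n h X i) * z ^ e \<le> R"
    if le: "L ^ (a + e) * P ^ b * q ^ c * n ^ d \<le> (n * P) ^ t * L"
  proof -
    have "(\<Prod>i\<in>sym_diff X Y. flip_cost L P q n h X i) * z ^ e =
      2 ^ c * (L ^ a * P ^ b * q ^ c * n ^ d * z ^ e)"
      using prod_flip_cost[OF fin] by (simp add: a_def b_def c_def d_def power_mult_distrib mult_ac)
    also have "\<dots> \<le> 2 ^ c * (L ^ a * P ^ b * q ^ c * n ^ d * L ^ e)"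
      using z nn q by (intro mult_left_mono power_mono mult_nonneg_nonneg) auto
    also have "\<dots> = 2 ^ c * (L ^ (a + e) * P ^ b * q ^ c * n ^ d)" by (simp add: power_add mult_ac)
    also have "\<dots> \<le> R" unfolding R_def
      by (rule mult_mono[OF two le]) (use abcd nn q in auto)
    finally show ?thesis .
  qed
  have Y: "(\<Prod>i\<in>sym_diff X Y. flip_cost L P q n h Y i) * z ^ e \<le> R"
    if le: "q ^ (a + e) * n ^ b * L ^ c * P ^ d \<le> (n * P) ^ t * L"
  proof -
    have "(\<Prod>i\<in>sym_diff X Y. flip_cost L P q n h Y i) * z ^ e =
      2 ^ a * (q ^ a * n ^ b * L ^ c * P ^ d * z ^ e)"
      using prod_flip_cost[OF fin(2,1)]
      by (simp add: Un_commute a_def b_def c_def d_def power_mult_distrib mult_ac)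
    also have "\<dots> \<le> 2 ^ a * (q ^ a * n ^ b * L ^ c * P ^ d * q ^ e)"
      using z nn q Lq by (intro mult_left_mono power_mono mult_nonneg_nonneg) auto
    also have "\<dots> = 2 ^ a * (q ^ (a + e) * n ^ b * L ^ c * P ^ d)" by (simp add: power_add mult_ac)
    also have "\<dots> \<le> R" unfolding R_def
      by (rule mult_mono[OF two le]) (use abcd nn q in auto)
    finally show ?thesis .
  qed
  show ?thesis using min_product_bound[OF P PL Ln q key abcd] X Y by blast
qed

text \<open>
  Every near pair is charged to an endpoint from which it is cheap. The factor 2 is there
  because this may be the first or the second member of an ordered pair.
\<close>
lemma card_adjacent_pairs_le:
  fixes L P q z :: real
  assumes \<B>: "\<B> \<subseteq> Pow {..<n}"
    and small: "\<And>X. X \<in> \<B> \<Longrightarrow> real (card X) \<le> L"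
    and high: "\<And>X. X \<in> \<B> \<Longrightarrow> real (card (X - {..<h})) \<le> P" and h: "real h \<le> 2 * q"
    and P: "1 \<le> P" and PL: "P \<le> L" and Ln: "L \<le> real n" and q: "q\<^sup>2 = n * L" "0 \<le> q"
    and key: "L ^ 4 \<le> n * P ^ 3" and z: "0 < z" "z \<le> L"
  shows "real (card (adjacent_pairs (near (2 * t + 1)) \<B>)) \<le>
    2 * (card \<B> * (2 ^ (2 * t + 1) * ((n * P) ^ t * L) / z ^ (2 * t + 1) * exp (4 * z)))"
proof -
  define r where "r = 2 * t + 1"
  define R where "R = 2 ^ r * ((n * P) ^ t * L)"
  define \<G> where "\<G> X = {Y \<in> \<B>. near r X Y \<and>
    (\<Prod>i\<in>sym_diff X Y. flip_cost L P q n h X i) * z ^ (r - card (sym_diff X Y)) \<le> R}" for X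
  have fin: "finite \<B>" using \<B> by (rule finite_subset) simp
  have finX: "finite X" if "X \<in> \<B>" for X using that \<B> finite_subset by blast
  have pos: "0 < P" "0 < L" "0 < real n" using P PL Ln by linarith+
  have "0 < q\<^sup>2" using pos q by simp
  then have qpos: "0 < q" using q(2) by (metis less_le zero_eq_power2)
  have R0: "0 \<le> R" using pos by (simp add: R_def)
  have \<G>: "real (card (\<G> X)) \<le> R / z ^ r * exp (4 * z)" if X: "X \<in> \<B>" for X
  proof -
    have Xn: "X \<subseteq> {..<n}" using \<B> X by auto
    have "real (card (\<G> X)) \<le> R / z ^ r * exp (\<Sum>i<n. z / flip_cost L P q n h X i)"
      by (rule card_cheap_neighbours)
        (use Xn \<B> z pos qpos R0 in \<open>auto simp: \<G>_def flip_cost_def near_def\<close>)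
    also have "\<dots> \<le> R / z ^ r * exp (4 * z)"
      using sum_inverse_flip_cost_le[of z L P q n X h] pos qpos z small[OF X] high[OF X] h Xn R0
      by (intro mult_left_mono) auto
    finally show ?thesis .
  qed
  have finG: "finite (\<G> X)" for X using fin by (simp add: \<G>_def)
  have cheap: "Y \<in> \<G> X \<or> X \<in> \<G> Y" if "X \<in> \<B>" "Y \<in> \<B>" "near r X Y" for X Y
    using cheap_from_one_side[OF P PL Ln q key less_imp_le[OF z(1)] z(2) finX[OF that(1)] finX[OF that(2)], of t h]
      that near_commute[OF that(3)] unfolding \<G>_def R_def r_def near_def by (auto simp: Un_commute)
  have "adjacent_pairs (near r) \<B> \<subseteq> Sigma \<B> \<G> \<union> prod.swap ` Sigma \<B> \<G>"
    using cheap by (force simp: adjacent_pairs_def image_iff)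
  then have "card (adjacent_pairs (near r) \<B>) \<le> card (Sigma \<B> \<G> \<union> prod.swap ` Sigma \<B> \<G>)"
    using fin finG by (intro card_mono) auto
  also have "\<dots> \<le> card (Sigma \<B> \<G>) + card (prod.swap ` Sigma \<B> \<G>)" by (rule card_Un_le)
  also have "\<dots> \<le> 2 * card (Sigma \<B> \<G>)"
    using card_image_le[of "Sigma \<B> \<G>" prod.swap] fin finG by simp
  also have "card (Sigma \<B> \<G>) = (\<Sum>X\<in>\<B>. card (\<G> X))" using fin finG by simp
  finally have "real (card (adjacent_pairs (near r) \<B>)) \<le> 2 * (\<Sum>X\<in>\<B>. real (card (\<G> X)))"
    by (metis of_nat_le_iff of_nat_mult of_nat_numeral of_nat_sum)
  also have "(\<Sum>X\<in>\<B>. real (card (\<G> X))) \<le> (\<Sum>X\<in>\<B>. R / z ^ r * exp (4 * z))"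
    using \<G> by (rule sum_mono)
  finally show ?thesis by (simp add: R_def r_def)
qed

section \<open>The discrete cube\<close>

definition ones :: "nat \<Rightarrow> (nat \<Rightarrow> nat) \<Rightarrow> nat set" where
  "ones n x = {i \<in> {..<n}. x i = 1}"

lemma inj_on_ones: "inj_on (ones n) (cube n)"
proof (rule inj_onI)
  fix x y assume x: "x \<in> cube n" and y: "y \<in> cube n" and eq: "ones n x = ones n y"
  show "x = y"
  proof (rule PiE_ext)
    show "x \<in> {..<n} \<rightarrow>\<^sub>E {0, 1}" "y \<in> {..<n} \<rightarrow>\<^sub>E {0, 1}" using x y by (auto simp: cube_def)
    fix i assume i: "i \<in> {..<n}"
    then have "x i \<in> {0, 1}" "y i \<in> {0, 1}" using x y by (auto simp: cube_def dest: PiE_mem)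
    moreover have "x i = 1 \<longleftrightarrow> y i = 1" using eq i by (auto simp: ones_def set_eq_iff)
    ultimately show "x i = y i" by auto
  qed
qed

lemma hamming_ones:
  assumes "x \<in> cube n" "y \<in> cube n"
  shows "hamming n x y = card (sym_diff (ones n x) (ones n y))"
proof -
  have "x i \<in> {0, 1}" "y i \<in> {0, 1}" if "i < n" for i
    using assms that by (auto simp: cube_def dest: PiE_mem)
  then have "{i \<in> {..<n}. x i \<noteq> y i} = sym_diff (ones n x) (ones n y)"
    by (fastforce simp: ones_def)
  then show ?thesis by (simp add: hamming_def)
qed

lemma finite_cube: "finite (cube n)"
  unfolding cube_def by (intro finite_PiE) auto

lemma twice_edges_in_le:
  assumes A: "A \<subseteq> cube n"
  shows "2 * edges_in n r A \<le> card (adjacent_pairs (near r) (ones n ` A))"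
proof -
  have fin: "finite A" using A finite_cube finite_subset by blast
  define E where "E = {e \<in> Q_edges n r. e \<subseteq> A}"
  define Adj where "Adj = adjacent_pairs (Q_adj n r) A"
  have finO: "finite Adj" unfolding Adj_def using fin by (rule finite_adjacent_pairs)
  have finE: "finite E" using fin by (simp add: E_def finite_subset[of _ "Pow A"] subset_eq)
  have sym: "Q_adj n r x y \<Longrightarrow> Q_adj n r y x" for x y
    by (simp add: Q_adj_def hamming_def eq_commute)
  have two: "card {p \<in> Adj. {fst p, snd p} = e} = 2" if "e \<in> E" for e
  proof -
    have "e \<in> Q_edges n r" "e \<subseteq> A" using that by (simp_all add: E_def)
    then obtain x y where e: "e = {x, y}" "Q_adj n r x y" "x \<in> A" "y \<in> A"
      unfolding Q_edges_def by blast
    then have "x \<noteq> y" by (simp add: Q_adj_def)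
    have "{p \<in> Adj. {fst p, snd p} = e} = {(x, y), (y, x)}"
      using e sym by (auto simp: Adj_def adjacent_pairs_def doubleton_eq_iff)
    then show ?thesis using \<open>x \<noteq> y\<close> by simp
  qed
  have "2 * card E = (\<Sum>e\<in>E. card {p \<in> Adj. {fst p, snd p} = e})" using two by simp
  also have "\<dots> = card (\<Union>e\<in>E. {p \<in> Adj. {fst p, snd p} = e})"
    using finE finO by (subst card_UN_disjoint) auto
  also have "\<dots> \<le> card Adj" using finO by (intro card_mono) auto
  also have "\<dots> \<le> card (adjacent_pairs (near r) (ones n ` A))"
  proof (rule card_inj_on_le)
    show "inj_on (map_prod (ones n) (ones n)) Adj"
      by (rule inj_on_subset[OF map_prod_inj_on[OF inj_on_ones inj_on_ones]])
        (auto simp: Adj_def adjacent_pairs_def Q_adj_def)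
    show "map_prod (ones n) (ones n) ` Adj \<subseteq> adjacent_pairs (near r) (ones n ` A)"
      using hamming_ones inj_on_ones[of n]
      by (auto simp: Adj_def adjacent_pairs_def Q_adj_def near_def dest: inj_onD)
    show "finite (adjacent_pairs (near r) (ones n ` A))" using fin by (simp add: finite_adjacent_pairs)
  qed
  finally show ?thesis by (simp add: edges_in_def E_def)
qed

lemma D_attained:
  assumes "m \<le> 2 ^ n"
  obtains A where "A \<subseteq> cube n" "card A = m" "D m n r = edges_in n r A"
proof -
  let ?S = "{edges_in n r A | A. A \<subseteq> cube n \<and> card A = m}"
  have "card (cube n) = 2 ^ n" by (simp add: cube_def card_PiE numeral_2_eq_2)
  then obtain A0 where "A0 \<subseteq> cube n" "card A0 = m"
    using assms by (metis obtain_subset_with_card_n)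
  then have "?S \<noteq> {}" by blast
  moreover have "finite ?S"
    by (rule finite_subset[of _ "edges_in n r ` Pow (cube n)"]) (use finite_cube in auto)
  ultimately have "D m n r \<in> ?S" unfolding D_def by (rule Max_in[rotated])
  then show ?thesis using that by blast
qed

text \<open>
  If \<open>ell\<close> is the rounded quotient, then P is \<open>ell\<close>. Otherwise P = L, which
  is at most twice its integer part, and the bound P on the elements beyond the threshold is the
  bound on the size of the whole set.
\<close>
lemma ell_cases:
  fixes m n :: nat
  defines "L \<equiv> log 2 (real m)"
  assumes L: "1 \<le> L" "L \<le> real n"
  obtains P where "1 \<le> P" "P \<le> L" "P \<le> 2 * real_of_int (ell m n)"
    "P = L \<or> L < real n \<and> 2 * L / (log 2 (real n) - log 2 L) \<le> P"
proof (cases "L < real n \<and> \<lceil>2 * L / (log 2 (real n) - log 2 L)\<rceil> \<le> \<lfloor>L\<rfloor>")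
  case True
  let ?Q = "2 * L / (log 2 (real n) - log 2 L)"
  have "0 < log 2 (real n) - log 2 L" using True L(1) by simp
  then have "0 < ?Q" using L(1) by simp
  then have one: "1 \<le> \<lceil>?Q\<rceil>" by linarith
  have "ell m n = \<lceil>?Q\<rceil>" using True by (simp add: ell_def L_def)
  then show ?thesis using True one that[of "real_of_int \<lceil>?Q\<rceil>"] by linarith
next
  case False
  then have "ell m n = \<lfloor>L\<rfloor>" using L(2) by (auto simp: ell_def L_def)
  moreover have "1 \<le> \<lfloor>L\<rfloor>" using L(1) by simp
  ultimately have "L \<le> 2 * real_of_int (ell m n)" by linarith
  then show ?thesis using L(1) that[of L] by simp
qed

theorem theorem3:
  fixes m n t :: nat
  assumes "0 < m" and "0 < n" and "0 < t"
    and "2 ^ t \<le> m" and "m \<le> 2 ^ n"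
  shows "real (D m n (2 * t + 1))
    \<le> (16 * exp 1 / real (2 * t + 1)) ^ (2 * t + 1)
        * (real n * real_of_int (ell m n)) ^ t * real m * log 2 (real m)"
proof -
  define L where "L = log 2 (real m)"
  define r where "r = 2 * t + 1"
  define q where "q = sqrt (real n * L)"
  define h where "h = nat \<lceil>q\<rceil>"
  define z where "z = real r / 4"
  have "2 ^ t \<le> real m" using assms(4) by (metis of_nat_le_iff of_nat_numeral of_nat_power)
  then have Lt: "real t \<le> L" unfolding L_def by (simp add: le_log_of_power)
  have "real m \<le> 2 ^ n" using assms(5) by (metis of_nat_le_iff of_nat_numeral of_nat_power)
  then have Ln: "L \<le> real n"
    unfolding L_def using assms(1) by (intro log2_of_power_le) auto
  have L1: "1 \<le> L" using Lt assms(3) by linarith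
  obtain P where P: "1 \<le> P" "P \<le> L" "P \<le> 2 * real_of_int (ell m n)"
    and P_cases: "P = L \<or> L < real n \<and> 2 * L / (log 2 (real n) - log 2 L) \<le> P"
    using ell_cases[of m n] L1 Ln unfolding L_def by blast
  have key: "L ^ 4 \<le> real n * P ^ 3"
    using P_cases
  proof
    assume "P = L"
    have "L * L ^ 3 \<le> real n * L ^ 3" using Ln L1 by (intro mult_right_mono) auto
    then show ?thesis using \<open>P = L\<close> by (simp add: power_numeral_reduce)
  next
    assume "L < real n \<and> 2 * L / (log 2 (real n) - log 2 L) \<le> P"
    then show ?thesis using fourth_power_le[of L "real n" P] L1 by simp
  qed
  have "1 * 1 \<le> real n * L" using L1 Ln by (intro mult_mono) auto
  then have q: "q\<^sup>2 = real n * L" "1 \<le> q" by (simp_all add: q_def)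
  have h: "q \<le> real h" "real h \<le> 2 * q" using q(2) unfolding h_def by linarith+
  obtain A where A: "A \<subseteq> cube n" "card A = m" "D m n r = edges_in n r A"
    using D_attained[OF assms(5)] by blast
  have "ones n ` A \<subseteq> Pow {..<n}" by (auto simp: ones_def)
  then obtain \<B> where \<B>: "\<B> \<subseteq> Pow {..<n}" "card \<B> = card (ones n ` A)"
    and more: "card (adjacent_pairs (near r) (ones n ` A)) \<le> card (adjacent_pairs (near r) \<B>)"
    and down: "\<And>X i. X \<in> \<B> \<Longrightarrow> i \<in> X \<Longrightarrow> X - {i} \<in> \<B>"
    and shift: "\<And>X i j. \<lbrakk>X \<in> \<B>; j \<in> X; i \<notin> X; i < j\<rbrakk> \<Longrightarrow> insert i (X - {j}) \<in> \<B>"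
    by (rule exists_compressed_family[of "ones n ` A" n r]) blast
  have cardB: "card \<B> = m"
    using \<B>(2) A inj_on_subset[OF inj_on_ones A(1)] by (simp add: card_image)
  have fin: "finite \<B>" using \<B>(1) by (rule finite_subset) simp
  have finX: "finite X" if "X \<in> \<B>" for X using that \<B>(1) finite_subset by blast
  have small: "real (card X) \<le> L" if "X \<in> \<B>" for X
    using card_le_log_card_family[OF down fin that finX[OF that]] by (simp add: cardB L_def)
  have high: "real (card (X - {..<h})) \<le> P" if X: "X \<in> \<B>" for X
  proof -
    let ?p = "card (X - {..<h})"
    have pL: "real ?p \<le> L" using small[OF X] card_mono[OF finX[OF X], of "X - {..<h}"] by auto
    show ?thesis
      using P_cases
    proof
      assume "P = L"
      then show ?thesis using pL by simp
    next
      assume "L < real n \<and> 2 * L / (log 2 (real n) - log 2 L) \<le> P"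
      moreover have "real (h choose ?p) \<le> real m"
        using choose_le_card_family[OF down shift fin finX[OF X] X] by (simp add: cardB)
      ultimately show ?thesis
        using high_part_le[of L "real n" "real m" h ?p] L1 assms(1) h(1) pL
        by (simp add: L_def q_def)
    qed
  qed
  have r: "0 < r" "real r \<le> 4 * L" using Lt assms(3) by (simp_all add: r_def)
  have "2 * D m n r \<le> card (adjacent_pairs (near r) \<B>)"
    using twice_edges_in_le[OF A(1), of r] A(3) more by linarith
  then have "2 * real (D m n r) \<le> real (card (adjacent_pairs (near r) \<B>))"
    by (metis of_nat_le_iff of_nat_mult of_nat_numeral)
  also have "\<dots> \<le> 2 * (card \<B> * (2 ^ r * ((n * P) ^ t * L) / z ^ r * exp (4 * z)))"
    unfolding r_def
    by (rule card_adjacent_pairs_le[where h = h and q = q])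
      (use \<B>(1) small high h P Ln q key r in \<open>auto simp: z_def r_def\<close>)
  finally have "real (D m n r) \<le> real m * (2 ^ r * ((n * P) ^ t * L) / z ^ r * exp (4 * z))"
    by (simp add: cardB)
  also have "\<dots> = (8 * exp 1 / r) ^ r * (n * P) ^ t * real m * L"
    using r by (simp add: z_def power_divide power_mult_distrib exp_of_nat_mult[symmetric] field_simps
      flip: power_mult_distrib)
  also have "\<dots> \<le> (8 * exp 1 / r) ^ r * (2 ^ r * (n * real_of_int (ell m n)) ^ t) * real m * L"
  proof -
    have "(n * P) ^ t \<le> (2 * (n * real_of_int (ell m n))) ^ t"
      using P by (intro power_mono) (auto simp: mult.left_commute[of 2] intro: mult_left_mono)
    also have "\<dots> = 2 ^ t * (n * real_of_int (ell m n)) ^ t" by (rule power_mult_distrib)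
    also have "\<dots> \<le> 2 ^ r * (n * real_of_int (ell m n)) ^ t"
      using P by (intro mult_right_mono power_increasing) (auto simp: r_def)
    finally show ?thesis using L1 by (intro mult_right_mono mult_left_mono) auto
  qed
  also have "\<dots> = (16 * exp 1 / r) ^ r * (n * real_of_int (ell m n)) ^ t * real m * L"
  proof -
    have "(8 * exp 1 / real r) ^ r * 2 ^ r = (16 * exp 1 / real r) ^ r"
      by (simp flip: power_mult_distrib)
    then show ?thesis by (metis mult.assoc)
  qed
  finally show ?thesis by (simp add: r_def L_def)
qed

end
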